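(* Let $d\ge 1$, $n\ge 0$ and let $(x_i,g_i)_{0\le i\le n}\in(\mathbb{R}^d\times\mathbb{R}^d)^{n+1}$ be such that the points $x_i$ are pairwise distinct. Then for all $\mu,L>0$ the following two assertions are equivalent: (a) There exists $f\in \operatorname{RSI}^-(\mu)\cap\operatorname{EB}^+(L)$ such that $\nabla f(x_i)=g_i$ for all $0\le i\le n$. (b) There exists a nonempty closed convex set $X^*\subseteq\mathbb{R}^d$ such that for all $0\le i\le n$, $$\|g_i\|_2\le L\|x_i-x_i^*\|_2\quad\text{and}\quad \langle g_i\mid x_i-x_i^*\rangle\ge\mu\|x_i-x_i^*\|_2^2,$$ where $x_i^*$ is the orthogonal projection of $x_i$ onto $X^*$.
   Context: Let $\mathcal{F}$ be the set of differentiable functions $f:\mathbb{R}^d\to\mathbb{R}$ whose set of global minimizers $X_f^*$ is nonempty and convex (it is closed by continuity of $f$). For $x\in\mathbb{R}^d$ let $x_f^*$ denote the orthogonal projection of $x$ onto $X_f^*$. For $\mu>0$, $\operatorname{RSI}^-(\mu)$ (lower restricted secant inequality) is the set of $f\in\mathcal{F}$ such that $\langle\nabla f(x)\mid x-x_f^*\rangle\ge\mu\|x-x_f^*\|_2^2$ for all $x\in\mathbb{R}^d$. For $L>0$, $\operatorname{EB}^+(L)$ (upper error bound) is the set of $f\in\mathcal{F}$ such that $\|\nabla f(x)\|_2\le L\|x-x_f^*\|_2$ for all $x\in\mathbb{R}^d$. Here $\langle\cdot\mid\cdot\rangle$ is the Euclidean inner product and $\|\cdot\|_2$ the Euclidean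 norm. *)

theory Defs
  imports "HOL-Analysis.Analysis"
begin

definition minimizers :: "(real ^ 'd \<Rightarrow> real) \<Rightarrow> (real ^ 'd) set"
  where "minimizers f = {x. \<forall>y. f x \<le> f y}"

(* Only meaningful at points of differentiability, where the vector D is unique. *)
definition gradient :: "(real ^ 'd \<Rightarrow> real) \<Rightarrow> real ^ 'd \<Rightarrow> real ^ 'd"
  where "gradient f x = (THE D. GDERIV f x :> D)"

lemma gradient_eqI:
  assumes "GDERIV f x :> D"
  shows "gradient f x = D"
proof -
  have "D' = D" if "GDERIV f x :> D'" for D'
  proof -
    have "(\<lambda>h. inner h D') = (\<lambda>h. inner h D)"
      using has_derivative_unique[OF that[unfolded gderiv_def] assms[unfolded gderiv_def]] .
    then have "inner h D' = inner h D" for h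
      by (rule fun_cong)
    then show ?thesis
      using vector_eq_ldot by blast
  qed
  with assms show ?thesis
    unfolding gradient_def by (rule the_equality)
qed

lemma GDERIV_gradient:
  assumes "f differentiable (at x)"
  shows "GDERIV f x :> gradient f x"
proof -
  obtain f' where f': "(f has_derivative f') (at x)"
    using assms unfolding differentiable_def by blast
  define D where "D = adjoint f' 1"
  have "f' h = inner h D" for h
    using adjoint_works[OF has_derivative_linear[OF f'], of h 1] unfolding D_def by simp
  then have "f' = (\<lambda>h. inner h D)"
    by (rule ext)
  with f' have "GDERIV f x :> D"
    unfolding gderiv_def by simp
  moreover from this have "gradient f x = D"
    by (rule gradient_eqI)
  ultimately show ?thesis
    by simp
qed

definition F_class :: "(real ^ 'd \<Rightarrow> real) set"
  where "F_class = {f. (\<forall>x. f differentiable (at x)) \<and> minimizers f \<noteq> {} \<and> convex (minimizers f)}"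

(* The set minimizers f is nonempty, closed and convex for f in F_class, so closest_point
   is the orthogonal projection onto it. *)
definition RSI_lower :: "real \<Rightarrow> (real ^ 'd \<Rightarrow> real) set"
  where "RSI_lower \<mu> = {f \<in> F_class. \<forall>x.
    inner (gradient f x) (x - closest_point (minimizers f) x)
      \<ge> \<mu> * (norm (x - closest_point (minimizers f) x))\<^sup>2}"

definition EB_upper :: "real \<Rightarrow> (real ^ 'd \<Rightarrow> real) set"
  where "EB_upper L = {f \<in> F_class. \<forall>x.
    norm (gradient f x) \<le> L * norm (x - closest_point (minimizers f) x)}"

end

theory Submission
  imports Defs
begin

text \<open>
  If \<open>f\<close> interpolates the data, its set of minimizers is itself a suitable \<open>X\<close>. The substance is
  the converse: from \<open>X\<close> one has to build \<open>f\<close>, and one can arrange that \<open>X\<close> is exactly its set of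
  minimizers. Write \<open>u(y)\<close> for \<open>y\<close> minus its projection onto \<open>X\<close>. The conditions on a gradient \<open>G\<close>
  at \<open>y\<close> say that \<open>G\<close> lies in a convex set \<open>admissible \<mu> L (u y)\<close>, the intersection of a ball and a
  half-space.

  Suppose first \<open>\<mu> \<le> L\<close>. With \<open>c = (\<mu> + L) / 2\<close>, the function \<open>f\<^sub>0 y = c / 2 * norm (u y)^2\<close> is
  differentiable with gradient \<open>c u(y)\<close>, because the projection is nonexpansive. This gradient is
  admissible, with a slack in both inequalities proportional to \<open>L - \<mu>\<close>. To move the gradient at
  \<open>x\<^sub>i\<close> from \<open>c u(x\<^sub>i)\<close> to \<open>g\<^sub>i\<close>, add the bump \<open>\<psi>(norm (y - x\<^sub>i)) * inner w (y - x\<^sub>i)\<close>, where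
  \<open>w = g\<^sub>i - c u(x\<^sub>i)\<close>, \<open>\<psi> 0 = 1\<close>, and \<open>\<psi>\<close> vanishes outside a small radius \<open>\<epsilon>\<close>.

  The difficulty is that \<open>g\<^sub>i\<close> may lie on the boundary of its admissible set, so that at \<open>x\<^sub>i\<close> no
  slack is left to absorb errors. At distance \<open>r\<close> from \<open>x\<^sub>i\<close> the new gradient is the convex
  combination of \<open>c u(y)\<close> and \<open>c u(y) + w\<close> with weights \<open>1 - \<psi>\<close> and \<open>\<psi>\<close>, plus an error of size
  at most \<open>r * \<bar>\<psi>' r\<bar> * norm w\<close>. The first summand contributes slack of order \<open>1 - \<psi>\<close>, the second
  violates the constraints by \<open>O(r)\<close>. So everything works if both \<open>r\<close> and \<open>r * \<bar>\<psi>' r\<bar>\<close> are small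
  multiples of \<open>1 - \<psi> r\<close>. A profile with \<open>1 - \<psi> r\<close> behaving like \<open>(r / \<epsilon>) powr \<eta>\<close> for a small
  exponent \<open>\<eta>\<close> has this property: its logarithmic derivative is \<open>\<eta> / r\<close>. It has a cusp at the
  centre, which does no harm because there it is multiplied by a function that vanishes to first
  order. The bound on the profile is \<open>profile_bounds\<close>, the trade-off between slack and errors is \<open>admissible_near\<close>, and
  \<open>admissible_bump\<close> chooses the parameters. As the points are distinct, the bumps can be given
  disjoint supports, so that they do not interact.

  If \<open>\<mu> > L\<close>, the Cauchy-Schwarz inequality forces all \<open>x\<^sub>i\<close> into \<open>X\<close> and all \<open>g\<^sub>i\<close> to be \<open>0\<close>; the
  constant function interpolates, with all of space as its set of minimizers.
\<close>

section \<open>The squared distance to a closed convex set\<close>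

lemma GDERIV_squeeze:
  fixes f :: "'a::real_inner \<Rightarrow> real"
  assumes bound: "\<And>y. \<bar>f y - f x - inner (y - x) D\<bar> \<le> H y * norm (y - x)"
    and H: "(H \<longlongrightarrow> 0) (at x)"
  shows "GDERIV f x :> D"
  unfolding gderiv_def
proof (rule has_derivativeI_sandwich[of 1])
  show "bounded_linear (\<lambda>h. inner h D)"
    by (rule bounded_linear_inner_left)
  show "norm (f y - f x - inner (y - x) D) / norm (y - x) \<le> H y" if "y \<noteq> x" for y
    using bound[of y] that by (simp add: divide_le_eq)
qed (use H in auto)

text \<open>
  The projection of \<open>x\<close> competes with that of \<open>y\<close>. Used with \<open>x\<close> and \<open>y\<close> in both orders, this
  bounds the squared distance from both sides by its first-order expansion.
\<close>
lemma dist_closest_point_sq_step: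
  fixes X :: "'a::euclidean_space set"
  assumes "closed X" "X \<noteq> {}"
  shows "(norm (y - closest_point X y))\<^sup>2 
      \<le> (norm (x - closest_point X x))\<^sup>2 + 2 * inner (y - x) (x - closest_point X x) + (norm (y - x))\<^sup>2"
proof -
  have "norm (y - closest_point X y) \<le> norm (y - closest_point X x)"
    using closest_point_le[OF assms(1) closest_point_in_set[OF assms, of x], of y]
    by (simp add: dist_norm)
  then have "(norm (y - closest_point X y))\<^sup>2 \<le> (norm (y - closest_point X x))\<^sup>2"
    by simp
  also have "\<dots> = (norm ((x - closest_point X x) + (y - x)))\<^sup>2"
    by simp
  also have "\<dots> = (norm (x - closest_point X x))\<^sup>2 + 2 * inner (y - x) (x - closest_point X x) + (norm (y - x))\<^sup>2"
    by (simp only: power2_norm_eq_inner) (simp add: inner_commute algebra_simps)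
  finally show ?thesis .
qed

lemma closest_point_residual_lipschitz:
  fixes X :: "'a::euclidean_space set"
  assumes "closed X" "X \<noteq> {}" "convex X"
  shows "norm ((y - closest_point X y) - (x - closest_point X x)) \<le> 2 * norm (y - x)"
proof -
  have "(y - closest_point X y) - (x - closest_point X x)
      = (y - x) - (closest_point X y - closest_point X x)"
    by simp
  then have "norm ((y - closest_point X y) - (x - closest_point X x))
      \<le> norm (y - x) + norm (closest_point X y - closest_point X x)"
    by (metis norm_triangle_ineq4)
  then show ?thesis
    using closest_point_lipschitz[OF assms(3,1,2), of y x] by (simp add: dist_norm)
qed

lemma GDERIV_dist_closest_point_sq:
  fixes X :: "'a::euclidean_space set"
  assumes X: "closed X" "X \<noteq> {}" "convex X"
  shows "GDERIV (\<lambda>y. (norm (y - closest_point X y))\<^sup>2) x :> 2 *\<^sub>R (x - closest_point X x)"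
proof (rule GDERIV_squeeze)
  fix y
  let ?u = "\<lambda>z. z - closest_point X z"
  have upper: "(norm (?u y))\<^sup>2 \<le> (norm (?u x))\<^sup>2 + 2 * inner (y - x) (?u x) + (norm (y - x))\<^sup>2"
    by (rule dist_closest_point_sq_step[OF X(1,2)])
  have lower: "(norm (?u x))\<^sup>2 \<le> (norm (?u y))\<^sup>2 + 2 * inner (x - y) (?u y) + (norm (y - x))\<^sup>2"
    using dist_closest_point_sq_step[OF X(1,2), of x y] by (simp add: norm_minus_commute)
  have "\<bar>inner (y - x) (?u y - ?u x)\<bar> \<le> norm (y - x) * norm (?u y - ?u x)"
    by (rule Cauchy_Schwarz_ineq2)
  also have "\<dots> \<le> norm (y - x) * (2 * norm (y - x))"
    by (intro mult_left_mono closest_point_residual_lipschitz X) simp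
  finally have cs: "\<bar>inner (y - x) (?u y - ?u x)\<bar> \<le> 2 * (norm (y - x))\<^sup>2"
    by (simp add: power2_eq_square)
  have e1: "2 * inner (x - y) (?u y) = - (2 * inner (y - x) (?u x)) - 2 * inner (y - x) (?u y - ?u x)"
    by (simp add: inner_diff_right inner_diff_left)
  have "\<bar>(norm (?u y))\<^sup>2 - (norm (?u x))\<^sup>2 - 2 * inner (y - x) (?u x)\<bar> \<le> 5 * (norm (y - x))\<^sup>2"
  proof -
    have "\<bar>A - B - 2 * I\<bar> \<le> 5 * K"
      if "A \<le> B + 2 * I + K" "B \<le> A + (- (2 * I) - 2 * J) + K" "- J \<le> 2 * K" "0 \<le> K" for A B I J K :: real
      using that by (intro abs_leI) linarith+
    from this[OF upper lower[unfolded e1] abs_le_D2[OF cs] zero_le_power2] show ?thesis .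
  qed
  then show "\<bar>(norm (?u y))\<^sup>2 - (norm (?u x))\<^sup>2 - inner (y - x) (2 *\<^sub>R ?u x)\<bar>
      \<le> (5 * norm (y - x)) * norm (y - x)"
    by (simp add: power2_eq_square)
next
  show "((\<lambda>y. 5 * norm (y - x)) \<longlongrightarrow> 0) (at x)"
    by (rule tendsto_eq_intros refl | simp)+
qed

section \<open>Bumps whose errors are dominated by their deviation from 1\<close>

text \<open>
  Squaring the positive part makes the profile differentiable at \<open>r = \<epsilon>\<close>, where it reaches \<open>0\<close>.
\<close>
definition profile :: "real \<Rightarrow> real \<Rightarrow> real \<Rightarrow> real"
  where "profile \<epsilon> \<eta> r = (max 0 (1 - (r / \<epsilon>) powr \<eta>))\<^sup>2"

definition profile' :: "real \<Rightarrow> real \<Rightarrow> real \<Rightarrow> real"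
  where "profile' \<epsilon> \<eta> r = - 2 * max 0 (1 - (r / \<epsilon>) powr \<eta>) * (\<eta> * (r / \<epsilon>) powr \<eta> / r)"

text \<open>
  The first-order error is at most \<open>(y - t)^2\<close> in each of the four combinations of signs.
\<close>
lemma DERIV_max0_sq: "DERIV (\<lambda>t::real. (max 0 t)\<^sup>2) t :> 2 * max 0 t"
proof -
  have "GDERIV (\<lambda>t::real. (max 0 t)\<^sup>2) t :> 2 * max 0 t"
  proof (rule GDERIV_squeeze)
    fix y :: real
    consider "0 \<le> y" "0 \<le> t" | "y \<le> 0" "t \<le> 0" | "0 \<le> y" "t \<le> 0" | "y \<le> 0" "0 \<le> t"
      by linarith
    then have "\<bar>(max 0 y)\<^sup>2 - (max 0 t)\<^sup>2 - (y - t) * (2 * max 0 t)\<bar> \<le> (y - t)\<^sup>2"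
    proof cases
      case 1
      have "y\<^sup>2 - t\<^sup>2 - (y - t) * (2 * t) = (y - t)\<^sup>2"
        by (simp add: power2_eq_square algebra_simps)
      with 1 show ?thesis by (simp add: max_def)
    next
      case 2
      then show ?thesis by (simp add: max_def)
    next
      case 3
      then have "y\<^sup>2 \<le> (y - t)\<^sup>2" by (intro power_mono) auto
      with 3 show ?thesis by (simp add: max_def)
    next
      case 4
      then have "y * t \<le> 0" by (simp add: mult_nonpos_nonneg)
      have "\<bar>- t\<^sup>2 - (y - t) * (2 * t)\<bar> \<le> (y - t)\<^sup>2"
      proof -
        have "- t\<^sup>2 - (y - t) * (2 * t) = t\<^sup>2 - 2 * (y * t)" "(y - t)\<^sup>2 = y\<^sup>2 + (t\<^sup>2 - 2 * (y * t))"
          by (simp_all add: power2_eq_square algebra_simps)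
        moreover have "0 \<le> y\<^sup>2" "0 \<le> t\<^sup>2"
          by simp_all
        ultimately show ?thesis
          using \<open>y * t \<le> 0\<close> by (simp only: abs_of_nonneg)
      qed
      with 4 show ?thesis by (cases "y = 0") (simp_all add: max_def)
    qed
    then show "\<bar>(max 0 y)\<^sup>2 - (max 0 t)\<^sup>2 - inner (y - t) (2 * max 0 t)\<bar> \<le> norm (y - t) * norm (y - t)"
      by (simp add: power2_eq_square)
  next
    show "((\<lambda>y. norm (y - t)) \<longlongrightarrow> 0) (at t)"
      by (rule tendsto_eq_intros refl | simp)+
  qed
  then show ?thesis by simp
qed

lemma DERIV_profile:
  assumes "0 < \<epsilon>" "0 < r"
  shows "DERIV (profile \<epsilon> \<eta>) r :> profile' \<epsilon> \<eta> r"
proof -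
  have "DERIV (\<lambda>r. 1 - (r / \<epsilon>) powr \<eta>) r :> - (\<eta> * (r / \<epsilon>) powr \<eta> / r)"
    using assms by (auto intro!: derivative_eq_intros simp: powr_diff field_simps)
  from DERIV_chain2[OF DERIV_max0_sq this] show ?thesis
    unfolding profile_def[abs_def] profile'_def by simp
qed

lemma profile_outside:
  assumes "0 < \<epsilon>" "0 < \<eta>" "\<epsilon> \<le> r"
  shows "profile \<epsilon> \<eta> r = 0" "profile' \<epsilon> \<eta> r = 0"
proof -
  have "1 \<le> (r / \<epsilon>) powr \<eta>"
    using assms by (intro ge_one_powr_ge_zero) auto
  then show "profile \<epsilon> \<eta> r = 0" "profile' \<epsilon> \<eta> r = 0"
    by (simp_all add: profile_def profile'_def)
qed

text \<open>
  The last two bounds are what the profile is made for. With \<open>a = (r / \<epsilon>) powr \<eta>\<close>, the deviation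
  \<open>1 - (1 - a)^2\<close> is at least \<open>a\<close>, while \<open>r / \<epsilon> \<le> a\<close> since \<open>\<eta> \<le> 1\<close>, and differentiating a power
  and multiplying by \<open>r\<close> only costs the factor \<open>\<eta>\<close>.
\<close>
lemma profile_bounds:
  assumes "0 < \<epsilon>" "0 < \<eta>" "\<eta> \<le> 1" "0 \<le> r" "r \<le> \<epsilon>"
  shows "0 \<le> profile \<epsilon> \<eta> r" "profile \<epsilon> \<eta> r \<le> 1"
    and "r \<le> \<epsilon> * (1 - profile \<epsilon> \<eta> r)"
    and "\<bar>profile' \<epsilon> \<eta> r\<bar> * r \<le> 2 * \<eta> * (1 - profile \<epsilon> \<eta> r)"
proof -
  define a where "a = (r / \<epsilon>) powr \<eta>"
  have a: "0 \<le> a" "a \<le> 1"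
    using assms by (auto simp: a_def intro: powr_le1)
  have psi: "profile \<epsilon> \<eta> r = (1 - a)\<^sup>2"
    using a by (simp add: profile_def a_def[symmetric])
  have "a * a \<le> a"
    using a by (simp add: mult_left_le)
  then have gap: "a \<le> 1 - profile \<epsilon> \<eta> r"
    unfolding psi by (simp add: power2_eq_square algebra_simps)
  show "0 \<le> profile \<epsilon> \<eta> r"
    by (simp add: profile_def)
  show "profile \<epsilon> \<eta> r \<le> 1"
    using gap a by linarith
  have "(r / \<epsilon>) powr 1 \<le> a"
    unfolding a_def using assms by (intro powr_mono') auto
  then have "r / \<epsilon> \<le> a"
    using assms by simp
  then have "r / \<epsilon> \<le> 1 - profile \<epsilon> \<eta> r"
    using gap by linarith
  then show "r \<le> \<epsilon> * (1 - profile \<epsilon> \<eta> r)"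
    using assms by (simp add: divide_le_eq mult.commute)
  have "\<bar>profile' \<epsilon> \<eta> r\<bar> * r \<le> 2 * (1 - a) * (\<eta> * a)"
    using a assms by (simp add: profile'_def a_def[symmetric] abs_mult)
  also have "\<dots> \<le> 2 * 1 * (\<eta> * a)"
    using a assms by (intro mult_mono) auto
  also have "\<dots> \<le> 2 * \<eta> * (1 - profile \<epsilon> \<eta> r)"
    using gap assms by (simp add: mult_left_mono)
  finally show "\<bar>profile' \<epsilon> \<eta> r\<bar> * r \<le> 2 * \<eta> * (1 - profile \<epsilon> \<eta> r)" .
qed

lemma profile_tendsto_1:
  fixes p :: "'a::real_normed_vector"
  assumes "0 < \<epsilon>" "0 < \<eta>"
  shows "((\<lambda>y. profile \<epsilon> \<eta> (norm (y - p))) \<longlongrightarrow> 1) (at p)"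
proof -
  have "((\<lambda>y. norm (y - p) / \<epsilon>) \<longlongrightarrow> 0) (at p)"
    using assms by (auto intro!: tendsto_eq_intros)
  then have "((\<lambda>y. (norm (y - p) / \<epsilon>) powr \<eta>) \<longlongrightarrow> 0 powr \<eta>) (at p)"
    using assms by (intro tendsto_powr') auto
  then have "((\<lambda>y. (max 0 (1 - (norm (y - p) / \<epsilon>) powr \<eta>))\<^sup>2) \<longlongrightarrow> (max 0 (1 - 0))\<^sup>2) (at p)"
    using assms by (intro tendsto_intros) auto
  then show ?thesis
    by (simp add: profile_def)
qed

text \<open>
  The bump is \<open>\<psi> y * inner w (y - p)\<close> and the number \<open>s\<close> is the value of \<open>\<psi>\<close> at \<open>y\<close>. The
  gradient deviates from \<open>s *\<^sub>R w\<close> only by the term that contains the derivative of the profile.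
\<close>
lemma sublinear_bump:
  fixes p w :: "'a::euclidean_space"
  assumes "0 < \<epsilon>" "0 < \<delta>"
  obtains \<theta> :: "'a \<Rightarrow> real" and T :: "'a \<Rightarrow> 'a"
  where "\<And>y. GDERIV \<theta> y :> T y"
    and "T p = w"
    and "\<And>y. \<epsilon> \<le> norm (y - p) \<Longrightarrow> \<theta> y = 0 \<and> T y = 0"
    and "\<And>y. norm (y - p) \<le> \<epsilon> \<Longrightarrow> \<bar>\<theta> y\<bar> \<le> \<epsilon> * norm w \<and>
      (\<exists>s. 0 \<le> s \<and> s \<le> 1 \<and> norm (y - p) \<le> \<epsilon> * (1 - s)
        \<and> norm (T y - s *\<^sub>R w) \<le> \<delta> * (1 - s) * norm w)"
proof -
  define \<eta> where "\<eta> = min 1 (\<delta> / 2)"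
  have eta: "0 < \<eta>" "\<eta> \<le> 1" "2 * \<eta> \<le> \<delta>"
    using assms by (auto simp: \<eta>_def)
  define \<psi> \<psi>' where "\<psi> = (\<lambda>y. profile \<epsilon> \<eta> (norm (y - p)))"
    and "\<psi>' = (\<lambda>y. profile' \<epsilon> \<eta> (norm (y - p)))"
  note psi_defs = \<psi>_def \<psi>'_def
  define \<theta> where "\<theta> = (\<lambda>y. \<psi> y * inner w (y - p))"
  define T where "T = (\<lambda>y. \<psi> y *\<^sub>R w + (\<psi>' y * inner w (y - p)) *\<^sub>R sgn (y - p))"
  have psi_p: "\<psi> p = 1"
    using eta by (simp add: psi_defs profile_def)
  show thesis
  proof
    show "T p = w"
      by (simp add: T_def psi_p)
  next
    fix y
    show "GDERIV \<theta> y :> T y"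
    proof (cases "y = p")
      case False
      have "GDERIV (\<lambda>y. norm (y - p)) y :> sgn (y - p)"
      proof -
        have "((\<lambda>y. y - p) has_derivative (\<lambda>h. h)) (at y)"
          by (auto intro!: derivative_eq_intros)
        from has_derivative_compose[OF this has_derivative_norm] False show ?thesis
          by (simp add: gderiv_def)
      qed
      moreover have "DERIV (profile \<epsilon> \<eta>) (norm (y - p)) :> profile' \<epsilon> \<eta> (norm (y - p))"
        using assms False by (intro DERIV_profile) auto
      ultimately have 1: "GDERIV \<psi> y :> \<psi>' y *\<^sub>R sgn (y - p)"
        unfolding psi_defs by (rule GDERIV_DERIV_compose)
      have "GDERIV (\<lambda>y. inner w (y - p)) y :> w"
        unfolding gderiv_def by (auto intro!: derivative_eq_intros simp: inner_commute)
      from GDERIV_mult[OF 1 this] show ?thesis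
        unfolding \<theta>_def T_def by (simp add: mult.commute)
    next
      case True
      \<comment> \<open>The profile has a cusp here, so the product rule does not apply; its continuity suffices.\<close>
      have "GDERIV \<theta> p :> w"
      proof (rule GDERIV_squeeze)
        fix z
        have "\<theta> z - \<theta> p - inner (z - p) w = (\<psi> z - 1) * inner w (z - p)"
          by (simp add: \<theta>_def inner_commute algebra_simps)
        then have "\<bar>\<theta> z - \<theta> p - inner (z - p) w\<bar> = \<bar>\<psi> z - 1\<bar> * \<bar>inner w (z - p)\<bar>"
          by (simp add: abs_mult)
        also have "\<dots> \<le> \<bar>\<psi> z - 1\<bar> * (norm w * norm (z - p))"
          by (intro mult_left_mono Cauchy_Schwarz_ineq2) auto
        finally show "\<bar>\<theta> z - \<theta> p - inner (z - p) w\<bar> \<le> (\<bar>\<psi> z - 1\<bar> * norm w) * norm (z - p)"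
          by (simp add: mult.assoc)
      next
        have "(\<psi> \<longlongrightarrow> 1) (at p)"
          unfolding psi_defs using assms eta by (intro profile_tendsto_1) auto
        then have "((\<lambda>z. \<bar>\<psi> z - 1\<bar> * norm w) \<longlongrightarrow> \<bar>1 - 1\<bar> * norm w) (at p)"
          by (intro tendsto_intros)
        then show "((\<lambda>z. \<bar>\<psi> z - 1\<bar> * norm w) \<longlongrightarrow> 0) (at p)"
          by simp
      qed
      then show ?thesis
        by (simp add: True T_def psi_p)
    qed
  next
    fix y assume "\<epsilon> \<le> norm (y - p)"
    then show "\<theta> y = 0 \<and> T y = 0"
      using profile_outside[of \<epsilon> \<eta> "norm (y - p)"] assms eta
      by (simp add: \<theta>_def T_def psi_defs)
  next
    fix y assume y: "norm (y - p) \<le> \<epsilon>"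
    have b: "0 \<le> \<psi> y" "\<psi> y \<le> 1" "norm (y - p) \<le> \<epsilon> * (1 - \<psi> y)"
        "\<bar>\<psi>' y\<bar> * norm (y - p) \<le> 2 * \<eta> * (1 - \<psi> y)"
      unfolding psi_defs using assms eta y by (auto intro!: profile_bounds)
    have cs: "\<bar>inner w (y - p)\<bar> \<le> norm w * norm (y - p)"
      by (rule Cauchy_Schwarz_ineq2)
    have "\<bar>\<theta> y\<bar> \<le> 1 * (norm w * \<epsilon>)"
      unfolding \<theta>_def abs_mult using b cs y
      by (intro mult_mono order_trans[OF cs] mult_left_mono) auto
    moreover have "norm (T y - \<psi> y *\<^sub>R w) \<le> \<delta> * (1 - \<psi> y) * norm w"
    proof -
      have "norm (T y - \<psi> y *\<^sub>R w) \<le> \<bar>\<psi>' y\<bar> * \<bar>inner w (y - p)\<bar> * 1"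
        by (auto simp: T_def abs_mult norm_sgn)
      also have "\<dots> \<le> \<bar>\<psi>' y\<bar> * (norm w * norm (y - p)) * 1"
        by (intro mult_right_mono mult_left_mono cs) auto
      also have "\<dots> = \<bar>\<psi>' y\<bar> * norm (y - p) * norm w"
        by simp
      also have "\<dots> \<le> 2 * \<eta> * (1 - \<psi> y) * norm w"
        by (intro mult_right_mono b) auto
      also have "\<dots> \<le> \<delta> * (1 - \<psi> y) * norm w"
        using eta b by (intro mult_right_mono) auto
      finally show ?thesis .
    qed
    ultimately show "\<bar>\<theta> y\<bar> \<le> \<epsilon> * norm w \<and>
      (\<exists>s. 0 \<le> s \<and> s \<le> 1 \<and> norm (y - p) \<le> \<epsilon> * (1 - s)
        \<and> norm (T y - s *\<^sub>R w) \<le> \<delta> * (1 - s) * norm w)"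
      using b by (auto simp: mult.commute intro!: exI[of _ "\<psi> y"])
  qed
qed

section \<open>Admissible gradients\<close>

text \<open>
  The vector \<open>u\<close> stands for the displacement from the projection, so that the restricted secant
  inequality and the error bound become one membership statement.
\<close>
definition admissible :: "real \<Rightarrow> real \<Rightarrow> 'a::real_inner \<Rightarrow> 'a set"
  where "admissible \<mu> L u = {G. norm G \<le> L * norm u \<and> \<mu> * (norm u)\<^sup>2 \<le> inner G u}"

text \<open>
  Here \<open>v\<close> and \<open>u\<close> are the displacements at an interpolation point and at a point at distance
  \<open>r\<close> from it, \<open>s\<close> is the value of the cut-off and \<open>t\<close> the gradient of the bump. With
  \<open>c = (\<mu> + L) / 2\<close>, \<open>D = u - v\<close> and \<open>e = t - s *\<^sub>R w\<close>, the gradient splits into the parts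
  \<open>(1 - s) *\<^sub>R (c *\<^sub>R u)\<close>, \<open>s *\<^sub>R (g + c *\<^sub>R D)\<close> and \<open>e\<close>. The first satisfies both constraints with slack of
  order \<open>1 - s\<close>; the second violates them by \<open>O(r)\<close>, because \<open>g\<close> is admissible at \<open>v\<close> and \<open>D\<close> is
  \<open>O(r)\<close>; and \<open>r\<close> and \<open>norm e\<close> are at most small multiples of \<open>1 - s\<close>. The conditions on \<open>\<epsilon>\<close> and
  \<open>\<delta>\<close> let each of the two errors consume at most half of the slack.
\<close>
lemma admissible_near:
  fixes v g u t :: "'a::real_inner" and \<mu> L :: real
  defines "w \<equiv> g - ((\<mu> + L) / 2) *\<^sub>R v"
  assumes "0 < \<mu>" "\<mu> < L" and g: "g \<in> admissible \<mu> L v"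
    and eps: "0 < \<epsilon>" "4 * \<epsilon> \<le> norm v" "\<epsilon> * (48 * L + 32 * norm w / norm v) \<le> (L - \<mu>) * norm v"
    and del: "8 * (\<delta> * norm w) \<le> (L - \<mu>) * norm v"
    and u: "norm (u - v) \<le> 2 * r" "r \<le> \<epsilon>"
    and s: "0 \<le> s" "s \<le> 1" "r \<le> \<epsilon> * (1 - s)" and t: "norm (t - s *\<^sub>R w) \<le> \<delta> * (1 - s) * norm w"
  shows "((\<mu> + L) / 2) *\<^sub>R u + t \<in> admissible \<mu> L u"
proof -
  define c where "c = (\<mu> + L) / 2"
  define \<sigma> where "\<sigma> = (L - \<mu>) / 2"
  have w: "w = g - c *\<^sub>R v"
    by (simp add: w_def c_def)
  have c: "0 < c" "0 < \<sigma>" "\<mu> = c - \<sigma>" "L = c + \<sigma>" "c \<le> L" "\<sigma> \<le> L"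
    using assms by (auto simp: c_def \<sigma>_def field_simps)
  define D where "D = u - v"
  define e where "e = t - s *\<^sub>R w"
  define m U W where "m = norm v" and "U = norm u" and "W = norm w"
  have W: "0 \<le> W" and m: "0 < m" and r: "0 \<le> r" and D: "norm D \<le> 2 * r"
    using eps order_trans[OF norm_ge_zero u(1)] u by (auto simp: m_def W_def D_def)
  have e: "norm e \<le> (1 - s) * (\<delta> * W)"
    using t by (simp add: e_def W_def mult_ac)
  have Um: "U \<le> m + 2 * r" "m \<le> U + 2 * r"
    using D norm_triangle_ineq2[of u v] norm_triangle_ineq2[of v u]
    by (auto simp: U_def m_def D_def norm_minus_commute)
  then have U: "m \<le> 2 * U" "4 * r \<le> 2 * U"
    using eps u by (auto simp: m_def)
  have del': "4 * (\<delta> * W) \<le> \<sigma> * m"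
    using del by (simp add: \<sigma>_def W_def m_def)
  have eps': "\<epsilon> * (24 * L + 16 * W / m) \<le> \<sigma> * m"
    using eps(3) by (simp add: \<sigma>_def W_def m_def field_simps)
  have \<sigma>U: "\<sigma> * m \<le> 2 * (\<sigma> * U)"
    using U c by simp
  have decomp: "c *\<^sub>R u + t = (1 - s) *\<^sub>R (c *\<^sub>R u) + s *\<^sub>R (g + c *\<^sub>R D) + e"
    unfolding e_def D_def w by (simp add: algebra_simps)
  have EB: "norm (c *\<^sub>R u + t) \<le> L * U"
  proof -
    have "norm (g + c *\<^sub>R D) \<le> L * m + c * (2 * r)"
      using g D c by (intro order_trans[OF norm_triangle_ineq] add_mono)
        (auto simp: admissible_def m_def)
    also have "\<dots> \<le> L * (U + 2 * r) + L * (2 * r)"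
      using Um c r by (intro add_mono mult_left_mono mult_right_mono) auto
    finally have gD: "norm (g + c *\<^sub>R D) \<le> L * U + 4 * (L * r)"
      by (simp add: algebra_simps)
    have Lr: "L * r \<le> L * (\<epsilon> * (1 - s))"
      using s c by simp
    have s1: "s * (L * r) \<le> 1 * (L * r)"
      using s c r by (intro mult_right_mono) auto
    have "norm (c *\<^sub>R u + t) \<le> (1 - s) * (c * U) + s * norm (g + c *\<^sub>R D) + norm e"
      unfolding decomp
      using norm_triangle_ineq[of "(1 - s) *\<^sub>R (c *\<^sub>R u) + s *\<^sub>R (g + c *\<^sub>R D)" e]
        norm_triangle_ineq[of "(1 - s) *\<^sub>R (c *\<^sub>R u)" "s *\<^sub>R (g + c *\<^sub>R D)"] s c
      by (simp add: U_def)
    also have "\<dots> \<le> (1 - s) * (c * U) + s * (L * U + 4 * (L * r)) + (1 - s) * (\<delta> * W)"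
      using gD e s c by (intro add_mono mult_left_mono) auto
    also have "\<dots> \<le> (1 - s) * (c * U) + s * (L * U) + 4 * (L * (\<epsilon> * (1 - s))) + (1 - s) * (\<delta> * W)"
      using s1 Lr by (simp add: algebra_simps)
    also have "\<dots> = L * U - (1 - s) * (\<sigma> * U - 4 * (L * \<epsilon>) - \<delta> * W)"
      unfolding c(4) by (simp add: algebra_simps)
    also have "\<dots> \<le> L * U"
    proof -
      have "0 \<le> \<epsilon> * (16 * W / m)"
        using eps W m by simp
      then have "24 * (L * \<epsilon>) \<le> \<sigma> * m"
        using eps' by (simp add: algebra_simps)
      then have "0 \<le> \<sigma> * U - 4 * (L * \<epsilon>) - \<delta> * W"
        using del' \<sigma>U  by (smt (verit) mult_pos_pos c(2) m)
      then show ?thesis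
        using s by simp
    qed
    finally show ?thesis .
  qed
  have RSI: "\<mu> * U\<^sup>2 \<le> inner (c *\<^sub>R u + t) u"
  proof -
    have wv: "- (\<sigma> * m\<^sup>2) \<le> inner w v"
      using g by (simp add: admissible_def w m_def c(3) inner_diff_left
          power2_norm_eq_inner algebra_simps)
    have "m\<^sup>2 \<le> (U + 2 * r)\<^sup>2"
      using Um m by (intro power_mono) auto
    also have "\<dots> = U\<^sup>2 + 4 * (r * U) + 2 * (r * (2 * r))"
      by (simp add: power2_eq_square algebra_simps)
    also have "\<dots> \<le> U\<^sup>2 + 4 * (r * U) + 2 * (r * U)"
      using U r by (intro add_left_mono mult_left_mono) auto
    finally have "m\<^sup>2 \<le> U\<^sup>2 + 6 * (r * U)"
      by (simp add: mult.commute)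
    then have m2: "\<sigma> * m\<^sup>2 \<le> \<sigma> * (U\<^sup>2 + 6 * (r * U))"
      using c by simp
    have "\<bar>inner w D\<bar> \<le> W * (2 * r)"
      unfolding W_def by (rule order_trans[OF Cauchy_Schwarz_ineq2]) (simp add: D mult_left_mono)
    \<comment> \<open>The slack in the secant inequality is of order \<open>U^2\<close>; the factor inserted here lets one
      power of \<open>U\<close> be factored out of all the error terms.\<close>
    also have "\<dots> \<le> W * (2 * r) * (2 * U / m)"
    proof -
      have "1 \<le> 2 * U / m"
        using U m by (simp add: le_divide_eq)
      then show ?thesis
        using W r mult_left_mono[of 1 "2 * U / m" "W * (2 * r)"] by simp
    qed
    finally have wD: "\<bar>inner w D\<bar> \<le> 4 * (r * U * (W / m))"
      by (simp add: mult_ac)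
    have wu: "- (\<sigma> * U\<^sup>2) - r * U * (6 * \<sigma> + 4 * W / m) \<le> inner w u"
    proof -
      have "inner w u = inner w v + inner w D"
        by (simp add: D_def inner_diff_right)
      then show ?thesis
        using wv m2 wD by (simp add: algebra_simps)
    qed
    define K where "K = 6 * \<sigma> + 4 * W / m"
    have K: "0 \<le> K"
      using c W m by (simp add: K_def)
    have wu: "- (\<sigma> * U\<^sup>2) - r * U * K \<le> inner w u"
      using wu by (simp add: K_def)
    have eu: "- ((1 - s) * (\<delta> * W) * U) \<le> inner e u"
      using Cauchy_Schwarz_ineq2[of e u] mult_right_mono[OF e, of U] by (simp add: U_def)
    have "s * (r * U * K) \<le> 1 * (\<epsilon> * (1 - s) * U * K)"
      using s r K by (intro mult_mono) (auto simp: U_def)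
    moreover have "s * (- (\<sigma> * U\<^sup>2) - r * U * K) \<le> s * inner w u"
      using s wu by (intro mult_left_mono)
    moreover have "inner (c *\<^sub>R u + t) u = c * U\<^sup>2 + s * inner w u + inner e u"
      by (simp add: e_def U_def inner_add_left inner_diff_left power2_norm_eq_inner)
    ultimately have "c * U\<^sup>2 - s * (\<sigma> * U\<^sup>2) - \<epsilon> * (1 - s) * U * K
        - (1 - s) * (\<delta> * W) * U \<le> inner (c *\<^sub>R u + t) u"
      using eu by (simp add: algebra_simps)
    moreover have "c * U\<^sup>2 - s * (\<sigma> * U\<^sup>2) - \<epsilon> * (1 - s) * U * K
        - (1 - s) * (\<delta> * W) * U
      = \<mu> * U\<^sup>2 + (1 - s) * U * (\<sigma> * U - \<epsilon> * K - \<delta> * W)"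
      unfolding c(3) by (simp add: power2_eq_square algebra_simps)
    moreover have "0 \<le> (1 - s) * U * (\<sigma> * U - \<epsilon> * K - \<delta> * W)"
    proof -
      have "\<epsilon> * (6 * \<sigma>) \<le> \<epsilon> * (6 * L)"
        using eps c by simp
      then have "4 * (\<epsilon> * K) \<le> \<epsilon> * (24 * L + 16 * W / m)"
        by (simp add: K_def algebra_simps)
      then have "4 * (\<epsilon> * K) \<le> \<sigma> * m"
        using eps' by linarith
      then have "0 \<le> \<sigma> * U - \<epsilon> * K - \<delta> * W"
        using del' \<sigma>U by linarith
      then show ?thesis
        using s by (simp add: U_def)
    qed
    ultimately show ?thesis
      by linarith
  qed
  show ?thesis
    using EB RSI by (simp add: admissible_def c_def U_def)
qed

lemma exists_small_factor:
  fixes A B :: real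
  assumes "0 < B" "0 < M" "0 \<le> A"
  obtains \<epsilon> where "0 < \<epsilon>" "\<epsilon> \<le> M" "\<epsilon> * A < B"
proof
  have "B / (A + 1) * A < B"
    using assms by (simp add: field_simps)
  moreover have "min M (B / (A + 1)) * A \<le> B / (A + 1) * A"
    using assms by (intro mult_right_mono) auto
  ultimately show "min M (B / (A + 1)) * A < B"
    by linarith
qed (use assms in auto)

lemma admissible_scaleR:
  assumes "\<mu> \<le> L" "0 < \<mu>"
  shows "((\<mu> + L) / 2) *\<^sub>R u \<in> admissible \<mu> L u"
proof -
  have "\<bar>\<mu> + L\<bar> / 2 * norm u \<le> L * norm u" "\<mu> * (norm u)\<^sup>2 \<le> (\<mu> + L) / 2 * (norm u)\<^sup>2"
    using assms by (intro mult_right_mono; simp)+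
  then show ?thesis
    by (simp add: admissible_def power2_norm_eq_inner)
qed

text \<open>
  This is the equality case of the Cauchy-Schwarz inequality: expanding
  \<open>norm (g - \<mu> *\<^sub>R v)^2\<close> and inserting the two constraints leaves at most \<open>0\<close>.
\<close>
lemma admissible_extremal:
  fixes g v :: "'a::real_inner"
  assumes "0 < \<mu>" "g \<in> admissible \<mu> L v" "L \<le> \<mu> \<or> v = 0"
  shows "g = \<mu> *\<^sub>R v"
proof (cases "v = 0")
  case True
  then show ?thesis
    using assms by (simp add: admissible_def)
next
  case False
  with assms have "norm g \<le> \<mu> * norm v"
    by (auto simp: admissible_def intro: order_trans mult_right_mono)
  then have "(norm g)\<^sup>2 \<le> (\<mu> * norm v)\<^sup>2"
    by (intro power_mono) auto
  moreover have "\<mu> * (\<mu> * (norm v)\<^sup>2) \<le> \<mu> * inner g v"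
    using assms by (simp add: admissible_def)
  moreover have "(norm (g - \<mu> *\<^sub>R v))\<^sup>2 = (norm g)\<^sup>2 - 2 * (\<mu> * inner g v) + (\<mu> * norm v)\<^sup>2"
    by (simp only: power_mult_distrib power2_norm_eq_inner)
      (simp add: inner_diff_left inner_diff_right inner_commute algebra_simps power2_eq_square)
  ultimately have "(norm (g - \<mu> *\<^sub>R v))\<^sup>2 \<le> 0"
    by (simp add: power2_eq_square algebra_simps)
  then show ?thesis
    by simp
qed

section \<open>Interpolation\<close>

text \<open>
  Adding \<open>\<theta>\<close> to the quadratic of the squared distance corrects the gradient at the single point \<open>p\<close>
  without leaving the admissible sets and without creating or destroying minimizers. If \<open>\<mu> = L\<close>
  or \<open>p \<in> X\<close>, the gradient at \<open>p\<close> is already the right one and \<open>\<theta> = 0\<close> will do; otherwise there is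
  slack, and a sufficiently small bump fits.
\<close>
lemma admissible_bump:
  fixes X :: "'a::euclidean_space set"
  defines "u \<equiv> \<lambda>y. y - closest_point X y"
  assumes X: "closed X" "X \<noteq> {}" "convex X"
    and "0 < \<mu>" "\<mu> \<le> L" "0 < \<rho>" and g: "g \<in> admissible \<mu> L (u p)"
  shows "\<exists>\<theta> T. (\<forall>y. GDERIV \<theta> y :> T y) \<and> T p = g - ((\<mu> + L) / 2) *\<^sub>R u p
    \<and> (\<forall>y. \<rho> \<le> norm (y - p) \<longrightarrow> \<theta> y = 0 \<and> T y = 0)
    \<and> (\<forall>y. ((\<mu> + L) / 2) *\<^sub>R u y + T y \<in> admissible \<mu> L (u y))
    \<and> (\<forall>y. if y \<in> X then \<theta> y = 0 else 0 < (\<mu> + L) / 4 * (norm (u y))\<^sup>2 + \<theta> y)"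
proof (cases "\<mu> < L \<and> u p \<noteq> 0")
  case False
  have u0: "u y = 0 \<longleftrightarrow> y \<in> X" for y
    using closest_point_refl[OF X(1,2), of y] unfolding u_def by auto
  have "g = ((\<mu> + L) / 2) *\<^sub>R u p"
    using admissible_extremal[OF \<open>0 < \<mu>\<close> g] False \<open>\<mu> \<le> L\<close> by auto
  then show ?thesis
    using assms u0 by (intro exI[of _ "\<lambda>_. 0"]) (auto simp: GDERIV_const admissible_scaleR)
next
  case True
  then have \<mu>L: "\<mu> < L" and m: "0 < norm (u p)"
    by auto
  have u0: "u y = 0 \<longleftrightarrow> y \<in> X" for y
    using closest_point_refl[OF X(1,2), of y] unfolding u_def by auto
  define m where "m = norm (u p)"
  define w where "w = g - ((\<mu> + L) / 2) *\<^sub>R u p"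
  have pos: "0 < m" "0 < L" "0 < (L - \<mu>) * m"
    using m \<mu>L assms by (auto simp: m_def)
  have A: "0 \<le> 48 * L + 32 * norm w / m"
    using pos by simp
  obtain \<epsilon>1 where e1: "0 < \<epsilon>1" "\<epsilon>1 \<le> min \<rho> (m / 4)" "\<epsilon>1 * (48 * L + 32 * norm w / m) < (L - \<mu>) * m"
    using exists_small_factor[OF pos(3) _ A, of "min \<rho> (m / 4)"] pos assms by auto
  \<comment> \<open>The last bound keeps the bump below the quadratic, which is at least \<open>(\<mu> + L) / 4 * (m / 2)^2\<close>
    on the support, so that the sum stays positive there.\<close>
  obtain \<epsilon> where e2: "0 < \<epsilon>" "\<epsilon> \<le> \<epsilon>1" "\<epsilon> * norm w < (\<mu> + L) / 4 * (m / 2)\<^sup>2"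
    using exists_small_factor[OF _ e1(1) norm_ge_zero[of w], of "(\<mu> + L) / 4 * (m / 2)\<^sup>2"] pos assms by auto
  have "\<epsilon> * (48 * L + 32 * norm w / m) \<le> \<epsilon>1 * (48 * L + 32 * norm w / m)"
    using e2 A by (intro mult_right_mono) auto
  then have eps: "0 < \<epsilon>" "\<epsilon> \<le> \<rho>" "4 * \<epsilon> \<le> m" "\<epsilon> * (48 * L + 32 * norm w / m) \<le> (L - \<mu>) * m"
    using e1 e2 by auto
  obtain \<delta> where del: "0 < \<delta>" "8 * (\<delta> * norm w) \<le> (L - \<mu>) * m"
    using exists_small_factor[of "(L - \<mu>) * m" 1 "8 * norm w"] pos
    by (metis less_imp_le mult.left_commute norm_ge_zero zero_le_mult_iff zero_le_numeral zero_less_one)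
  obtain \<theta> T where bump: "\<And>y. GDERIV \<theta> y :> T y" "T p = w"
      "\<And>y. \<epsilon> \<le> norm (y - p) \<Longrightarrow> \<theta> y = 0 \<and> T y = 0"
      "\<And>y. norm (y - p) \<le> \<epsilon> \<Longrightarrow> \<bar>\<theta> y\<bar> \<le> \<epsilon> * norm w \<and>
      (\<exists>s. 0 \<le> s \<and> s \<le> 1 \<and> norm (y - p) \<le> \<epsilon> * (1 - s)
        \<and> norm (T y - s *\<^sub>R w) \<le> \<delta> * (1 - s) * norm w)"
    using sublinear_bump[OF eps(1) del(1), of p w] by metis
  have lip: "norm (u y - u p) \<le> 2 * norm (y - p)" for y
    unfolding u_def by (rule closest_point_residual_lipschitz[OF X])
  have adm: "((\<mu> + L) / 2) *\<^sub>R u y + T y \<in> admissible \<mu> L (u y)" for y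
  proof (cases "\<epsilon> \<le> norm (y - p)")
    case True
    then show ?thesis
      using bump(3) admissible_scaleR assms by simp
  next
    case False
    then obtain s where "0 \<le> s" "s \<le> 1" "norm (y - p) \<le> \<epsilon> * (1 - s)"
        "norm (T y - s *\<^sub>R w) \<le> \<delta> * (1 - s) * norm w"
      using bump(4)[of y] by auto
    then show ?thesis
      using admissible_near[OF \<open>0 < \<mu>\<close> \<mu>L g eps(1) _ _ _ lip[of y], of \<delta> s "T y"] eps del False
      by (simp add: m_def w_def)
  qed
  have val: "if y \<in> X then \<theta> y = 0 else 0 < (\<mu> + L) / 4 * (norm (u y))\<^sup>2 + \<theta> y" for y
  proof (cases "\<epsilon> \<le> norm (y - p)")
    case True
    then show ?thesis
      using bump(3) u0 assms by auto
  next
    case False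
    have "m \<le> norm (u y) + norm (u y - u p)"
      unfolding m_def by (metis norm_minus_commute norm_triangle_sub)
    then have big: "m / 2 \<le> norm (u y)"
      using lip[of y] False eps by linarith
    then have "y \<notin> X"
      using u0[of y] pos by auto
    have "(\<mu> + L) / 4 * (m / 2)\<^sup>2 \<le> (\<mu> + L) / 4 * (norm (u y))\<^sup>2"
      using big pos assms by (intro mult_left_mono power_mono) auto
    then have "0 < (\<mu> + L) / 4 * (norm (u y))\<^sup>2 + \<theta> y"
      using bump(4)[of y] e2(3) False by linarith
    with \<open>y \<notin> X\<close> show ?thesis
      by simp
  qed
  show ?thesis
  proof (intro exI[of _ \<theta>] exI[of _ T] conjI allI impI)
    show "\<theta> y = 0" "T y = 0" if "\<rho> \<le> norm (y - p)" for y
      using bump(3)[of y] that eps(2) by auto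
  qed (use bump(1,2) adm val in \<open>auto simp only: w_def\<close>)
qed

lemma GDERIV_sum:
  assumes "\<And>i. i \<in> I \<Longrightarrow> GDERIV (f i) x :> D i"
  shows "GDERIV (\<lambda>y. \<Sum>i\<in>I. f i y) x :> (\<Sum>i\<in>I. D i)"
  using assms unfolding gderiv_def inner_sum_right by (rule has_derivative_sum)

lemma closed_minimizers:
  assumes "f \<in> F_class"
  shows "closed (minimizers f)"
proof -
  have "continuous_on UNIV f"
    using assms by (auto simp: F_class_def intro!: differentiable_imp_continuous_on simp: differentiable_on_def)
  then have "closed {x. f x \<le> f y}" for y
    by (intro closed_Collect_le continuous_on_const)
  moreover have "minimizers f = (\<Inter>y. {x. f x \<le> f y})"
    by (auto simp: minimizers_def)
  ultimately show ?thesis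
    by auto
qed

lemma RSI_EB_memI:
  fixes f :: "real ^ 'd \<Rightarrow> real"
  assumes "\<And>y. GDERIV f y :> G y" "minimizers f = X" "X \<noteq> {}" "convex X"
    and "\<And>y. G y \<in> admissible \<mu> L (y - closest_point X y)"
  shows "f \<in> RSI_lower \<mu> \<inter> EB_upper L" "gradient f y = G y"
proof -
  have grad: "gradient f y = G y" for y
    by (rule gradient_eqI[OF assms(1)])
  have "f \<in> F_class"
    using assms(1-4) unfolding F_class_def gderiv_def differentiable_def by blast
  then show "f \<in> RSI_lower \<mu> \<inter> EB_upper L"
    using assms(2,5) by (simp add: RSI_lower_def EB_upper_def grad admissible_def)
  show "gradient f y = G y"
    by (rule grad)
qed

text \<open>
  Since the bumps have disjoint supports, at every point the sum over all of them agrees with a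
  single one, and the pointwise properties carry over from \<open>admissible_bump\<close>.
\<close>
lemma interpolation_of_admissible:
  fixes x g :: "nat \<Rightarrow> real ^ 'd"
  assumes inj: "inj_on x I" and I: "finite I" "I \<noteq> {}" and \<mu>L: "0 < \<mu>" "\<mu> \<le> L"
    and X: "closed X" "X \<noteq> {}" "convex X"
    and g: "\<And>i. i \<in> I \<Longrightarrow> g i \<in> admissible \<mu> L (x i - closest_point X (x i))"
  shows "\<exists>f \<in> RSI_lower \<mu> \<inter> EB_upper L. \<forall>i\<in>I. gradient f (x i) = g i"
proof -
  define u where "u = (\<lambda>y. y - closest_point X y)"
  define c where "c = (\<mu> + L) / 2"
  have u0: "u y = 0 \<longleftrightarrow> y \<in> X" for y
    using closest_point_refl[OF X(1,2), of y] unfolding u_def by auto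
  have "\<exists>\<rho>>0. \<forall>j\<in>I. j \<noteq> i \<longrightarrow> 2 * \<rho> \<le> norm (x i - x j)" if "i \<in> I" for i
  proof -
    obtain d where "0 < d" "\<forall>z\<in>x ` I. z \<noteq> x i \<longrightarrow> d \<le> dist (x i) z"
      using finite_set_avoid[of "x ` I" "x i"] I by auto
    then show ?thesis
      using inj that by (intro exI[of _ "d / 2"]) (auto simp: dist_norm inj_on_eq_iff)
  qed
  then obtain \<rho> where \<rho>: "\<And>i. i \<in> I \<Longrightarrow> 0 < \<rho> i"
      "\<And>i j. i \<in> I \<Longrightarrow> j \<in> I \<Longrightarrow> j \<noteq> i \<Longrightarrow> 2 * \<rho> i \<le> norm (x i - x j)"
    by metis
  define P where "P i \<theta> T \<longleftrightarrow> (\<forall>y. GDERIV \<theta> y :> T y) \<and> T (x i) = g i - c *\<^sub>R u (x i)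
    \<and> (\<forall>y. \<rho> i \<le> norm (y - x i) \<longrightarrow> \<theta> y = 0 \<and> T y = 0)
    \<and> (\<forall>y. c *\<^sub>R u y + T y \<in> admissible \<mu> L (u y))
    \<and> (\<forall>y. if y \<in> X then \<theta> y = 0 else 0 < (\<mu> + L) / 4 * (norm (u y))\<^sup>2 + \<theta> y)" for i \<theta> T
  have "\<exists>\<theta> T. P i \<theta> T" if "i \<in> I" for i
    unfolding P_def u_def c_def by (rule admissible_bump[OF X \<mu>L \<rho>(1)[OF that] g[OF that]])
  then obtain \<theta> T where "\<And>i. i \<in> I \<Longrightarrow> P i (\<theta> i) (T i)"
    by metis
  then have bump: "\<And>i y. i \<in> I \<Longrightarrow> GDERIV (\<theta> i) y :> T i y"
      "\<And>i. i \<in> I \<Longrightarrow> T i (x i) = g i - c *\<^sub>R u (x i)"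
      "\<And>i y. i \<in> I \<Longrightarrow> \<rho> i \<le> norm (y - x i) \<Longrightarrow> \<theta> i y = 0 \<and> T i y = 0"
      "\<And>i y. i \<in> I \<Longrightarrow> c *\<^sub>R u y + T i y \<in> admissible \<mu> L (u y)"
      "\<And>i y. i \<in> I \<Longrightarrow> if y \<in> X then \<theta> i y = 0 else 0 < (\<mu> + L) / 4 * (norm (u y))\<^sup>2 + \<theta> i y"
    unfolding P_def by blast+
  define f where "f = (\<lambda>y. (\<mu> + L) / 4 * (norm (u y))\<^sup>2 + (\<Sum>i\<in>I. \<theta> i y))"
  define G where "G = (\<lambda>y. c *\<^sub>R u y + (\<Sum>i\<in>I. T i y))"
  \<comment> \<open>The radius \<open>\<rho> i\<close> is at most half the distance from \<open>x i\<close> to any other point, so two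
    of the balls may touch but do not overlap.\<close>
  have disjoint: "\<theta> j y = 0 \<and> T j y = 0"
    if "k \<in> I" "j \<in> I" "j \<noteq> k" "norm (y - x k) < \<rho> k" for j k y
  proof -
    have "norm (x k - x j) \<le> norm (y - x k) + norm (y - x j)"
      by (metis dist_norm dist_triangle norm_minus_commute)
    then have "\<rho> j \<le> norm (y - x j)"
      using \<rho>(2)[of k j] \<rho>(2)[of j k] that by (simp add: norm_minus_commute)
    then show ?thesis
      using bump(3) that by blast
  qed
  have single: "(\<Sum>i\<in>I. \<theta> i y) = \<theta> k y" "(\<Sum>i\<in>I. T i y) = T k y"
    if "k \<in> I" "\<And>j. j \<in> I \<Longrightarrow> j \<noteq> k \<Longrightarrow> \<theta> j y = 0 \<and> T j y = 0" for k y
    unfolding sum.remove[OF I(1) that(1)] using that(2) by (simp_all add: sum.neutral)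
  have local: "\<exists>k\<in>I. f y = (\<mu> + L) / 4 * (norm (u y))\<^sup>2 + \<theta> k y \<and> G y = c *\<^sub>R u y + T k y" for y
  proof (cases "\<exists>k\<in>I. norm (y - x k) < \<rho> k")
    case True
    then obtain k where k: "k \<in> I" "norm (y - x k) < \<rho> k"
      by blast
    then show ?thesis
      using single[OF k(1) disjoint[OF k(1) _ _ k(2)]] unfolding f_def G_def by (intro bexI[of _ k]) auto
  next
    case False
    then have "\<theta> j y = 0 \<and> T j y = 0" if "j \<in> I" for j
      using bump(3)[OF that, of y] that by (meson not_le)
    moreover obtain k where k: "k \<in> I"
      using I by blast
    ultimately show ?thesis
      using single[OF k, of y] unfolding f_def G_def by (intro bexI[of _ k]) auto
  qed
  have deriv: "GDERIV f y :> G y" for y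
  proof -
    have "GDERIV (\<lambda>y. (norm (u y))\<^sup>2) y :> 2 *\<^sub>R u y"
      unfolding u_def by (rule GDERIV_dist_closest_point_sq[OF X])
    then have "GDERIV (\<lambda>y. (\<mu> + L) / 4 * (norm (u y))\<^sup>2) y :> c *\<^sub>R u y"
      by (rule GDERIV_subst[OF GDERIV_mult[OF GDERIV_const]]) (simp add: c_def field_simps)
    then show ?thesis
      unfolding f_def G_def using bump(1) by (intro GDERIV_add GDERIV_sum) auto
  qed
  have pos: "f y = 0 \<longleftrightarrow> y \<in> X" "0 \<le> f y" for y
  proof -
    obtain k where "k \<in> I" "f y = (\<mu> + L) / 4 * (norm (u y))\<^sup>2 + \<theta> k y"
      using local by blast
    then show "f y = 0 \<longleftrightarrow> y \<in> X" "0 \<le> f y"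
      using bump(5)[of k y] u0[of y] by (auto split: if_splits)
  qed
  have "minimizers f = X"
  proof -
    obtain z where z: "z \<in> X"
      using X by blast
    then have "f z = 0"
      using pos by blast
    then show ?thesis
      unfolding minimizers_def using pos by (smt (verit, best) Collect_cong Collect_mem_eq)
  qed
  moreover have "G y \<in> admissible \<mu> L (y - closest_point X y)" for y
    using local[of y] bump(4) unfolding u_def by metis
  ultimately have mem: "f \<in> RSI_lower \<mu> \<inter> EB_upper L" and grad: "gradient f y = G y" for y
    using RSI_EB_memI[OF deriv _ X(2,3)] by blast+
  have "gradient f (x i) = g i" if "i \<in> I" for i
  proof -
    have "G (x i) = c *\<^sub>R u (x i) + T i (x i)"
      unfolding G_def using single(2)[OF that] disjoint[OF that] \<rho>(1)[OF that] by simp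
    then show ?thesis
      using bump(2)[OF that] grad by simp
  qed
  with mem show ?thesis
    by blast
qed

theorem theorem1:
  fixes x g :: "nat \<Rightarrow> real ^ 'd" and n :: nat and \<mu> L :: real
  assumes "inj_on x {0..n}" and "\<mu> > 0" and "L > 0"
  shows "(\<exists>f \<in> RSI_lower \<mu> \<inter> EB_upper L. \<forall>i\<in>{0..n}. gradient f (x i) = g i) \<longleftrightarrow>
    (\<exists>X :: (real ^ 'd) set. X \<noteq> {} \<and> closed X \<and> convex X \<and>
      (\<forall>i\<in>{0..n}. norm (g i) \<le> L * norm (x i - closest_point X (x i)) \<and>
        inner (g i) (x i - closest_point X (x i)) \<ge> \<mu> * (norm (x i - closest_point X (x i)))\<^sup>2))"
  (is "?lhs \<longleftrightarrow> ?rhs")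
proof
  assume ?lhs
  then obtain f where f: "f \<in> RSI_lower \<mu>" "f \<in> EB_upper L" "\<forall>i\<in>{0..n}. gradient f (x i) = g i"
    by blast
  then have F: "f \<in> F_class"
    by (simp add: RSI_lower_def)
  show ?rhs
  proof (intro exI[of _ "minimizers f"] conjI ballI)
    show "minimizers f \<noteq> {}" "convex (minimizers f)" "closed (minimizers f)"
      using F closed_minimizers by (auto simp: F_class_def)
    fix i assume "i \<in> {0..n}"
    then have grad: "gradient f (x i) = g i"
      using f by blast
    show "norm (g i) \<le> L * norm (x i - closest_point (minimizers f) (x i))"
        "\<mu> * (norm (x i - closest_point (minimizers f) (x i)))\<^sup>2
          \<le> inner (g i) (x i - closest_point (minimizers f) (x i))"
      using f(1,2) unfolding RSI_lower_def EB_upper_def grad[symmetric] by blast+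
  qed
next
  assume ?rhs
  then obtain X where X: "closed X" "X \<noteq> {}" "convex X"
    and g: "\<And>i. i \<in> {0..n} \<Longrightarrow> g i \<in> admissible \<mu> L (x i - closest_point X (x i))"
    unfolding admissible_def by blast
  show ?lhs
  proof (cases "\<mu> \<le> L")
    case True
    then show ?thesis
      using assms X g by (intro interpolation_of_admissible[of x "{0..n}" \<mu> L X g]) auto
  next
    case False
    have "g i = 0" if "i \<in> {0..n}" for i
    proof -
      let ?v = "x i - closest_point X (x i)"
      have "g i = \<mu> *\<^sub>R ?v"
        using admissible_extremal[OF \<open>\<mu> > 0\<close> g[OF that]] False by simp
      then have "\<mu> * norm ?v \<le> L * norm ?v"
        using g[OF that] \<open>\<mu> > 0\<close> by (simp add: admissible_def)
      then have "?v = 0"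
        using False by (simp add: mult_le_cancel_right)
      with \<open>g i = \<mu> *\<^sub>R ?v\<close> show ?thesis
        by simp
    qed
    moreover have "(\<lambda>_. 0) \<in> RSI_lower \<mu> \<inter> EB_upper L" "gradient (\<lambda>_. 0) y = 0" for y :: "real ^ 'd"
      by (rule RSI_EB_memI[where G = "\<lambda>_. 0" and X = UNIV];
          auto simp: GDERIV_const minimizers_def admissible_def closest_point_self)+
    ultimately show ?thesis
      by (intro bexI[of _ "\<lambda>_. 0"]) auto
  qed
qed

end
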